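(* Let $f\in\mathcal{A}$ be such that $zf'(z)/f(z)$ has a Taylor series expansion of the form $1+a_2z^2+a_3z^3+\cdots$. If $f$ satisfies the subordination $$\left(\frac{zf'(z)}{f(z)}\right)^2+\frac{zf'(z)}{f(z)}\left(1+\frac{zf''(z)}{f'(z)}-\frac{zf'(z)}{f(z)}\right)+\frac{zf'(z)}{f(z)}\left(\frac{z^2f'''(z)}{f'(z)}-\frac{3z^2f''(z)}{f(z)}+\frac{2zf''(z)}{f'(z)}+2\left(\frac{zf'(z)}{f(z)}\right)^2-\frac{2zf'(z)}{f(z)}\right)\prec 1+\left(1+\frac{3}{2\sqrt{2}}\right)z,$$ then $f\in\mathcal{SL}$.
   Context: $\mathbb{D}=\{z\in\mathbb{C}:|z|<1\}$. $\mathcal{A}$ is the set of analytic functions $f$ on $\mathbb{D}$ with $f(0)=0$ and $f'(0)=1$. For analytic $f,g$ on $\mathbb{D}$, $f\prec g$ ($f$ is subordinate to $g$) means there is an analytic $w:\mathbb{D}\to\mathbb{D}$ with $w(0)=0$ and $f(z)=g(w(z))$ for all $z\in\mathbb{D}$; in particular the left-hand side of a subordination is understood to be an analytic function on $\mathbb{D}$ (after filling in removable singularities). $\mathcal{SL}$ (lemniscate starlike functions) is the class of $f\in\mathcal{A}$ with $zf'(z)/f(z)\prec\sqrt{1+z}$ (principal branch), i.e. $zf'(z)/f(z)$ takes values in $\{w:|w^2-1|<1,\ \operatorname{Re}w>0\}$ for $z\in\mathbb{D}$. *)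

theory Defs
  imports "HOL-Complex_Analysis.Complex_Analysis"
begin

abbreviation unit_disc :: "complex set" where
  "unit_disc \<equiv> ball 0 1"

definition class_A :: "(complex \<Rightarrow> complex) set" where
  "class_A = {f. f holomorphic_on unit_disc \<and> f 0 = 0 \<and> deriv f 0 = 1}"

definition subordinate :: "(complex \<Rightarrow> complex) \<Rightarrow> (complex \<Rightarrow> complex) \<Rightarrow> bool"
    (infix "\<prec>\<^sub>s" 50) where
  "f \<prec>\<^sub>s g \<longleftrightarrow>
     f holomorphic_on unit_disc \<and> g holomorphic_on unit_disc \<and>
     (\<exists>w. w holomorphic_on unit_disc \<and> w ` unit_disc \<subseteq> unit_disc \<and> w 0 = 0 \<and>
          (\<forall>z\<in>unit_disc. f z = g (w z)))"

text \<open>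
  Quotients such as \<open>z f'(z) / f(z)\<close> are meant with their removable singularities filled in
  (always the one at \<open>0\<close>, where the plain expression would be \<open>0 / 0 = 0\<close>). At a pole,
  \<^const>\<open>remove_sings\<close> returns the junk value \<open>0\<close>, but the function is then not continuous
  there, so the holomorphy required in \<^const>\<open>subordinate\<close> excludes poles in the disc.
\<close>

definition starlike_quotient :: "(complex \<Rightarrow> complex) \<Rightarrow> complex \<Rightarrow> complex" where
  "starlike_quotient f = remove_sings (\<lambda>z. z * deriv f z / f z)"

definition class_SL :: "(complex \<Rightarrow> complex) set" where
  "class_SL = {f \<in> class_A. starlike_quotient f \<prec>\<^sub>s (\<lambda>z. csqrt (1 + z))}"

end

theory Submission
  imports Defs
begin

text \<open>
  With \<open>p = z f' / f\<close>, the left-hand side of the subordination is \<open>p\<^sup>2 + z p' + z\<^sup>2 p''\<close>.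
  Put \<open>w = p\<^sup>2 - 1\<close>. If \<open>|w| < 1\<close> fails, take a point \<open>z\<^sub>0\<close> of least modulus where \<open>|w| = 1\<close>.
  As \<open>w\<close> vanishes to second order at \<open>0\<close>, the second-order form of Jack's lemma gives
  \<open>z\<^sub>0 w' = m w\<close> with \<open>m \<ge> 2\<close> and a lower bound for the second derivative of \<open>w\<close>; rewritten for \<open>p\<close>
  this puts \<open>p\<^sup>2 + z p' + z\<^sup>2 p''\<close> at distance at least \<open>1 + 3 / (2 \<surd>2)\<close> from \<open>1\<close>, a contradiction.
  Zeros of \<open>f\<close> away from the origin do not occur: they would be simple poles of \<open>p\<close> and hence triple poles
  of \<open>p\<^sup>2 + z p' + z\<^sup>2 p''\<close>.
\<close>

section \<open>Second-order Jack lemma: the maximum of \<open>|w|\<close> on a circle\<close>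

text \<open>Meant for the angular variable: \<open>\<phi> t\<close> will be \<open>|w|^2\<close> at
  angle \<open>t\<close> on the circle through \<open>z0\<close>. A positive \<open>d\<close> would
  make \<open>\<phi>'\<close> positive just to the right of the critical point \<open>x\<close>, so
  \<open>\<phi>\<close> would rise above its maximum.\<close>

lemma second_derivative_test_max:
  fixes \<phi> \<phi>' :: "real \<Rightarrow> real"
  assumes der: "\<And>t. (\<phi> has_real_derivative \<phi>' t) (at t)"
    and der2: "(\<phi>' has_real_derivative d) (at x)"
    and max: "\<And>t. \<phi> t \<le> \<phi> x"
  shows "\<phi>' x = 0" and "d \<le> 0"
proof -
  show crit: "\<phi>' x = 0"
    using DERIV_local_max[OF der[of x], of 1] max by simp
  show "d \<le> 0"
  proof (rule ccontr)
    assume "\<not> d \<le> 0"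
    then obtain e where e: "e > 0" "\<And>h. 0 < h \<Longrightarrow> h < e \<Longrightarrow> \<phi>' x < \<phi>' (x + h)"
      using DERIV_pos_inc_right[OF der2] by auto
    have "\<phi> x < \<phi> (x + e / 2)"
    proof (rule DERIV_pos_imp_increasing_open[where f = \<phi>])
      show "x < x + e / 2" using e by simp
      show "\<exists>y. (\<phi> has_real_derivative y) (at t) \<and> y > 0" if "x < t" "t < x + e / 2" for t
        using der[of t] e(2)[of "t - x"] that crit e(1) by auto
      show "continuous_on {x..x + e / 2} \<phi>"
        using der by (meson DERIV_isCont continuous_at_imp_continuous_on)
    qed
    then show False using max[of "x + e / 2"] by simp
  qed
qed

text \<open>The Schwarz lemma is used twice: for \<open>v\<close>, written as
  \<open>z * h z\<close>, and then for \<open>h\<close>, which vanishes at 0 because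
  \<open>h 0 = deriv v 0\<close>. The second use needs \<open>|h| < 1\<close> strictly; equality off
  the origin would make \<open>v\<close> a rotation, whose derivative at 0 has modulus 1.\<close>

lemma Schwarz_order_two:
  assumes hol: "v holomorphic_on ball 0 1" and "v 0 = 0" "deriv v 0 = 0"
    and lt: "\<And>z. norm z < 1 \<Longrightarrow> norm (v z) < 1" and z: "norm z < 1"
  shows "norm (v z) \<le> norm z ^ 2"
proof -
  obtain h where h: "h holomorphic_on ball 0 1" "\<And>z. norm z < 1 \<Longrightarrow> v z = z * h z"
      "deriv v 0 = h 0"
    using Schwarz3[OF hol \<open>v 0 = 0\<close>] by blast
  have h_lt: "norm (h y) < 1" if y: "norm y < 1" for y
  proof (cases "y = 0")
    case True
    then show ?thesis using h(3) assms(3) by simp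
  next
    case False
    have "norm (v y) \<noteq> norm y"
    proof
      assume "norm (v y) = norm y"
      then obtain \<alpha> where \<alpha>: "\<And>z. norm z < 1 \<Longrightarrow> v z = \<alpha> * z" "norm \<alpha> = 1"
        using Schwarz_Lemma(3)[OF hol \<open>v 0 = 0\<close> lt y] y False by auto
      have "eventually (\<lambda>z. z \<in> ball 0 1) (nhds (0::complex))"
        by (intro eventually_nhds_in_open) auto
      then have "eventually (\<lambda>z. v z = \<alpha> * z) (nhds 0)"
        by eventually_elim (simp add: \<alpha>)
      then have "deriv v 0 = deriv (\<lambda>z. \<alpha> * z) 0"
        by (intro deriv_cong_ev) auto
      then show False using \<alpha>(2) assms(3) by auto
    qed
    moreover have "norm (v y) \<le> norm y"
      using Schwarz_Lemma(1)[OF hol \<open>v 0 = 0\<close> lt y] by simp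
    ultimately have "norm y * norm (h y) < norm y * 1"
      using h(2)[OF y] by (simp add: norm_mult)
    then show ?thesis using False by (simp add: mult_less_cancel_left_pos)
  qed
  have "norm (h z) \<le> norm z"
    using Schwarz_Lemma(1)[OF h(1) _ h_lt z] h(3) assms(3) by simp
  then have "norm z * norm (h z) \<le> norm z * norm z"
    by (rule mult_left_mono) simp
  then show ?thesis using h(2)[OF z] by (simp add: norm_mult power2_eq_square)
qed

text \<open>All three conclusions come from \<open>|w|^2\<close> near \<open>z0\<close>. Along the
  circle it has a maximum there: the vanishing first angular derivative makes
  \<open>z0 * deriv w z0 / w z0\<close> real, and the sign of the second one gives the bound by
  \<open>m^2\<close>. Along the radius, \<open>w\<close> grows at most like \<open>s^2\<close>,
  which gives \<open>m \<ge> 2\<close>.\<close>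

lemma Jack_Miller_Mocanu:
  assumes hol: "w holomorphic_on ball 0 1" and "w 0 = 0" "deriv w 0 = 0"
    and z0: "norm z0 < 1" and w1: "norm (w z0) = 1"
    and lt: "\<And>z. norm z < norm z0 \<Longrightarrow> norm (w z) < 1"
  obtains m :: real where "m \<ge> 2" "z0 * deriv w z0 = of_real m * w z0"
    "Re (cnj (w z0) * (z0 * deriv w z0 + z0^2 * deriv (deriv w) z0)) \<ge> m^2"
proof -
  have "z0 \<noteq> 0" using w1 \<open>w 0 = 0\<close> by auto
  have d1: "(w has_field_derivative deriv w z) (at z)" if "norm z < 1" for z
    using holomorphic_derivI[OF hol open_ball, of z] that by simp
  have d2: "(deriv w has_field_derivative deriv (deriv w) z) (at z)" if "norm z < 1" for z
    using holomorphic_derivI[OF holomorphic_deriv[OF hol open_ball] open_ball, of z] that by simp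
  have le: "norm (w z) \<le> 1" if "norm z \<le> norm z0" for z
  proof (rule continuous_on_closure_norm_le[of "ball 0 (norm z0)" w])
    show "continuous_on (closure (ball 0 (norm z0))) w"
      using \<open>z0 \<noteq> 0\<close> z0
      by (intro holomorphic_on_imp_continuous_on holomorphic_on_subset[OF hol]) auto
    show "\<forall>y\<in>ball 0 (norm z0). norm (w y) \<le> 1" using lt by (auto intro: less_imp_le)
    show "z \<in> closure (ball 0 (norm z0))" using that \<open>z0 \<noteq> 0\<close> by auto
  qed
  define g where "g t = z0 * cis t" for t
  have g_lt: "norm (g t) < 1" for t by (simp add: g_def norm_mult z0)
  have gd: "(g has_vector_derivative \<i> * g t) (at t)" for t
  proof -
    have "((\<lambda>z. z0 * exp (\<i> * z)) has_field_derivative z0 * (\<i> * exp (\<i> * of_real t))) (at (of_real t))"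
      by (auto intro!: derivative_eq_intros)
    from has_vector_derivative_real_field[OF this, of UNIV] show ?thesis
      by (simp add: g_def[abs_def] cis_conv_exp mult_ac)
  qed
  define F where "F t = w (g t)" for t
  define F' where "F' t = \<i> * g t * deriv w (g t)" for t
  have Fd: "(F has_vector_derivative F' t) (at t)" for t
    using field_vector_diff_chain_at[OF gd d1[OF g_lt], of t]
    by (simp add: F_def[abs_def] F'_def o_def)
  have dwd: "((\<lambda>t. deriv w (g t)) has_vector_derivative \<i> * g t * deriv (deriv w) (g t)) (at t)" for t
    using field_vector_diff_chain_at[OF gd d2[OF g_lt], of t] by (simp add: o_def)
  have F'd: "(F' has_vector_derivative - (g t * deriv w (g t) + g t ^ 2 * deriv (deriv w) (g t))) (at t)" for t
  proof -
    have "((\<lambda>t. \<i> * g t) has_vector_derivative - g t) (at t)"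
      using has_vector_derivative_mult_right[OF gd, of \<i>] by (simp add: mult.assoc[symmetric])
    from has_vector_derivative_mult[OF this dwd] show ?thesis
      by (simp add: F'_def[abs_def] algebra_simps power2_eq_square)
  qed
  \<comment> \<open>By \<open>F'd\<close>, the second angular derivative of \<open>w\<close> at
    \<open>z0\<close>, that is of \<open>F\<close> at 0, is \<open>- L\<close>.\<close>
  define L where "L = z0 * deriv w z0 + z0 ^ 2 * deriv (deriv w) z0"
  have phid: "((\<lambda>t. Re (cnj (F t) * F t)) has_real_derivative 2 * Re (cnj (F t) * F' t)) (at t)" for t
  proof -
    have "((\<lambda>t. Re (cnj (F t) * F t)) has_real_derivative Re (cnj (F t) * F' t + cnj (F' t) * F t)) (at t)"
      by (intro derivative_intros has_vector_derivative_mult Fd)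
    then show ?thesis by (simp add: algebra_simps)
  qed
  have phidd: "((\<lambda>t. 2 * Re (cnj (F t) * F' t)) has_real_derivative
        2 * (Re (cnj (F 0) * (- L)) + Re (cnj (F' 0) * F' 0))) (at 0)"
  proof -
    have "((\<lambda>t. Re (cnj (F t) * F' t)) has_real_derivative Re (cnj (F 0) * (- L) + cnj (F' 0) * F' 0)) (at 0)"
      using F'd[of 0]
      by (intro derivative_intros has_vector_derivative_mult Fd) (simp add: g_def L_def)
    from DERIV_cmult[OF this, of 2] show ?thesis by (simp only: plus_complex.sel)
  qed
  have phi_max: "Re (cnj (F t) * F t) \<le> Re (cnj (F 0) * F 0)" for t
  proof -
    have "norm (F t) \<le> 1" unfolding F_def by (rule le) (simp add: g_def norm_mult)
    moreover have "norm (F 0) = 1" by (simp add: F_def g_def w1)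
    moreover have "Re (cnj x * x) = norm x ^ 2" for x
      by (metis complex_norm_square mult.commute Re_complex_of_real)
    ultimately show ?thesis by (simp add: power_le_one)
  qed
  have crit: "Re (cnj (w z0) * (\<i> * z0 * deriv w z0)) = 0"
    using second_derivative_test_max(1)[OF phid phidd phi_max] by (simp add: F_def F'_def g_def)
  have second: "Re (cnj (z0 * deriv w z0) * (z0 * deriv w z0)) \<le> Re (cnj (w z0) * L)"
    using second_derivative_test_max(2)[OF phid phidd phi_max] by (simp add: F_def F'_def g_def algebra_simps)
  define m where "m = Re (cnj (w z0) * (z0 * deriv w z0))"
  have ww: "w z0 * cnj (w z0) = 1" using w1 by (metis complex_norm_square of_real_1 one_power2)
  \<comment> \<open>The factor \<open>\<i>\<close> in \<open>crit\<close> turns the imaginary part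
    of this product into a real part, so \<open>crit\<close> says that the product is real.\<close>
  have "cnj (w z0) * (z0 * deriv w z0) = of_real m"
    using crit by (auto simp: m_def complex_eq_iff algebra_simps)
  then have zw: "z0 * deriv w z0 = of_real m * w z0"
    using ww by (metis mult.assoc mult.commute mult.left_neutral)
  have "cnj (z0 * deriv w z0) * (z0 * deriv w z0) = of_real (m ^ 2) * (w z0 * cnj (w z0))"
    unfolding zw by (simp add: power2_eq_square)
  then have L: "Re (cnj (w z0) * L) \<ge> m ^ 2" using second ww by (simp only: mult_1_right Re_complex_of_real)
  have "m \<ge> 2"
  proof -
    \<comment> \<open>\<open>R s\<close> is \<open>|w (s z0)|^2 - s^4\<close>.
      \<open>Schwarz_order_two\<close>, rescaled to the disc of radius \<open>|z0|\<close>, gives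
      \<open>R s \<le> 0 = R 1\<close> for \<open>0 < s < 1\<close>, so the derivative
      \<open>2 * m - 4\<close> of \<open>R\<close> at 1 cannot be negative.\<close>
    define R where "R s = Re (cnj (w (of_real s * z0)) * w (of_real s * z0)) - s ^ 4" for s :: real
    have growth: "R s \<le> R 1" if s: "0 < s" "s < 1" for s
    proof -
      have "norm (w (z0 * of_real s)) \<le> norm (of_real s :: complex) ^ 2"
      proof (rule Schwarz_order_two[where v = "\<lambda>z. w (z0 * z)"])
        show "(\<lambda>z. w (z0 * z)) holomorphic_on ball 0 1"
          using z0 \<open>z0 \<noteq> 0\<close>
          by (intro holomorphic_on_compose_gen[unfolded o_def, OF _ hol] holomorphic_intros)
             (auto simp: norm_mult intro!: le_less_trans[OF mult_left_le z0])
        show "deriv (\<lambda>z. w (z0 * z)) 0 = 0"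
        proof (rule DERIV_imp_deriv)
          have "(w has_field_derivative 0) (at (z0 * 0))" using d1[of 0] assms(3) by simp
          from DERIV_chain2[where g = "\<lambda>z. z0 * z", OF this, of z0 UNIV]
          show "((\<lambda>z. w (z0 * z)) has_field_derivative 0) (at 0)"
            by (auto intro!: derivative_eq_intros)
        qed
        show "norm (w (z0 * z)) < 1" if "norm z < 1" for z
          using that \<open>z0 \<noteq> 0\<close> by (intro lt) (simp add: norm_mult)
      qed (use s \<open>w 0 = 0\<close> in auto)
      then have "norm (w (of_real s * z0)) ^ 2 \<le> (s ^ 2) ^ 2"
        using s by (intro power_mono) (auto simp: mult.commute)
      moreover have "Re (cnj x * x) = norm x ^ 2" for x
        by (metis complex_norm_square mult.commute Re_complex_of_real)
      ultimately show ?thesis by (simp add: R_def w1)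
    qed
    have "((\<lambda>s. of_real s * z0) has_vector_derivative z0) (at 1)"
      by (auto intro!: derivative_eq_intros)
    from field_vector_diff_chain_at[OF this, of w "deriv w z0"] d1[OF z0]
    have Wd: "((\<lambda>s. w (of_real s * z0)) has_vector_derivative z0 * deriv w z0) (at 1)"
      by (simp add: o_def)
    have "((\<lambda>s. Re (cnj (w (of_real s * z0)) * w (of_real s * z0))) has_real_derivative
        Re (cnj (w (of_real 1 * z0)) * (z0 * deriv w z0) + cnj (z0 * deriv w z0) * w (of_real 1 * z0))) (at 1)"
      by (intro derivative_intros has_vector_derivative_mult Wd)
    then have "((\<lambda>s. Re (cnj (w (of_real s * z0)) * w (of_real s * z0))) has_real_derivative 2 * m) (at 1)"
      by (simp add: m_def algebra_simps)
    then have Rd: "(R has_real_derivative 2 * m - 4) (at 1)"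
      using DERIV_diff[OF _ DERIV_pow[of 4 "1::real"]] unfolding R_def by fastforce
    show "m \<ge> 2"
    proof (rule ccontr)
      assume "\<not> m \<ge> 2"
      then obtain e where e: "e > 0" "\<And>h. 0 < h \<Longrightarrow> h < e \<Longrightarrow> R 1 < R (1 - h)"
        using DERIV_neg_dec_left[OF Rd] by auto
      \<comment> \<open>The minimum stays below \<open>e\<close> and also keeps the point inside the
        interval from 0 to 1, where \<open>growth\<close> applies.\<close>
      have "R 1 < R (1 - min (e / 2) (1 / 2))" using e(1) by (intro e(2)) auto
      then show False using growth[of "1 - min (e / 2) (1 / 2)"] e(1) by (auto simp: min_def split: if_splits)
    qed
  qed
  then show thesis using that zw L unfolding L_def by blast
qed

section \<open>Geometry of the boundary of the lemniscate\<close>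

text \<open>For nonzero \<open>p\<close> of modulus \<open>r\<close> and argument \<open>t\<close>,
  the curve \<open>|p^2 - 1| = 1\<close> reads \<open>r^2 = 2 cos 2t\<close>, which is the relation
  between \<open>x = cos t\<close> and \<open>r\<close> assumed here. The sum is least at the vertex
  \<open>r = sqrt 2\<close>, \<open>x = 1\<close>: away from it the gain in
  \<open>3 / (2 * r)\<close> outweighs the loss \<open>1 - x\<close>.\<close>

lemma lemniscate_boundary_bound:
  fixes x r :: real
  assumes x: "0 \<le> x" "x \<le> 1" "4 * x ^ 2 = 2 + r ^ 2" and r: "0 < r" "r \<le> sqrt 2"
  shows "x + 3 / (2 * r) \<ge> 1 + 3 / (2 * sqrt 2)"
proof -
  define s where "s = sqrt 2"
  have s: "s > 0" "s * s = 2" and rs: "r \<le> s" using r by (auto simp: s_def)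
  \<comment> \<open>Passing to \<open>1 - x^2\<close> exposes the factor \<open>s - r\<close>, which
    the gain \<open>3 (s - r) / (2 s r)\<close> also contains. It remains to see that
    \<open>(s + r) * (s * r) \<le> 6\<close>; the worst case \<open>r = s\<close> gives
    \<open>4 * sqrt 2\<close>.\<close>
  have "1 - x \<le> 1 - x ^ 2" using x by (simp add: power2_eq_square mult_left_le)
  also have "\<dots> = (s - r) * (s + r) / 4"
    using x(3) s(2) by (simp add: algebra_simps power2_eq_square)
  also have "\<dots> \<le> (s - r) * (6 / (s * r)) / 4"
  proof -
    have "(s + r) * (s * r) \<le> (s + s) * (s * s)"
      using r s rs by (intro mult_mono) auto
    also have "\<dots> \<le> 6" 
    proof -
      have "s \<le> 1.5" unfolding s_def by (rule real_le_lsqrt) (auto simp: power2_eq_square)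
      then show ?thesis using s by auto
    qed
    finally have "s + r \<le> 6 / (s * r)" using r s by (simp add: pos_le_divide_eq)
    then show ?thesis using rs by (intro divide_right_mono mult_left_mono) auto
  qed
  also have "\<dots> = 3 / (2 * r) - 3 / (2 * s)"
    using r s(1) by (simp add: field_simps)
  finally show ?thesis by (simp add: s_def)
qed

text \<open>Here \<open>a\<close> and \<open>b\<close> stand for \<open>z p'\<close> and
  \<open>z p' + z^2 p''\<close> at the first boundary point, and their hypotheses are the Jack
  conclusions for \<open>w = p^2 - 1\<close>. With \<open>u = p / |p|\<close> the boundary equation
  becomes \<open>p^2 - 1 = u^4\<close>, and multiplying by the conjugate of \<open>u^3\<close>
  reduces the claim to a bound on real parts.\<close>

lemma lemniscate_admissible:
  fixes p a b :: complex and m :: real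
  assumes p: "Re p > 0" and w: "norm (p ^ 2 - 1) = 1" and m: "m \<ge> 2"
    and a: "2 * p * a = of_real m * (p ^ 2 - 1)"
    and b: "Re (cnj (p ^ 2 - 1) * (2 * a ^ 2 + 2 * p * b)) \<ge> m ^ 2"
  shows "norm (p ^ 2 + b - 1) \<ge> 1 + 3 / (2 * sqrt 2)"
proof -
  define r where "r = norm p"
  define u where "u = p / of_real r"
  have r: "r > 0" using p by (auto simp: r_def)
  have pu: "p = of_real r * u" using r by (simp add: u_def)
  have nu: "norm u = 1" using r by (simp add: u_def norm_divide r_def)
  then have uu: "u * cnj u = 1" by (simp add: complex_norm_square[symmetric])
  have nw: "(p ^ 2 - 1) * cnj (p ^ 2 - 1) = 1" using w by (metis complex_norm_square of_real_1 one_power2)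
  have pp: "p * cnj p = of_real (r ^ 2)" by (simp only: complex_norm_square r_def)
  \<comment> \<open>Expanding \<open>|p^2 - 1|^2 = 1\<close> cancels the constant; dividing by
    \<open>r^2\<close> afterwards gives \<open>usum\<close>, the polar equation of the
    lemniscate.\<close>
  have "p ^ 2 * cnj p ^ 2 = p ^ 2 + cnj p ^ 2" using nw by (simp add: algebra_simps)
  moreover have "p ^ 2 * cnj p ^ 2 = of_real (r ^ 4)"
    using pp by (simp add: power_mult_distrib[symmetric] flip: power_mult)
  ultimately have sum: "p ^ 2 + cnj p ^ 2 = of_real (r ^ 4)" by simp
  have "p ^ 2 + cnj p ^ 2 = of_real (r ^ 2) * (u ^ 2 + cnj u ^ 2)"
    by (simp add: pu power_mult_distrib distrib_left)
  with sum have "of_real (r ^ 2) * (u ^ 2 + cnj u ^ 2) = (of_real (r ^ 2) * of_real (r ^ 2) :: complex)"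
    by (simp flip: of_real_mult power_add)
  then have usum: "u ^ 2 + cnj u ^ 2 = of_real (r ^ 2)"
    using r by (simp only: mult_cancel_left) simp
  have wu: "p ^ 2 - 1 = u ^ 4"
  proof -
    have "u ^ 2 * (u ^ 2 + cnj u ^ 2) = u ^ 4 + (u * cnj u) ^ 2"
      by (simp add: algebra_simps power_mult_distrib flip: power_add)
    then have "u ^ 2 * of_real (r ^ 2) = u ^ 4 + 1" using usum uu by simp
    then show ?thesis by (simp add: pu power_mult_distrib algebra_simps)
  qed
  have Reu2: "Re (u ^ 2) = r ^ 2 / 2"
  proof -
    have "Re (u ^ 2 + cnj u ^ 2) = 2 * Re (u ^ 2)" by (simp flip: complex_cnj_power)
    then show ?thesis using usum by simp
  qed
  have a': "a = of_real (m / (2 * r)) * u ^ 3"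
  proof -
    have "u * (2 * of_real r * a) = u * (of_real m * u ^ 3)"
    proof -
      have "u * (2 * of_real r * a) = 2 * p * a" by (simp add: pu)
      also have "\<dots> = of_real m * u ^ 4" using a by (simp only: wu)
      finally show ?thesis by (simp only: power4_eq_xxxx power3_eq_cube mult_ac)
    qed
    moreover have "u \<noteq> 0" using nu by auto
    ultimately have "2 * of_real r * a = of_real m * u ^ 3" by (simp only: mult_cancel_left) simp
    then show ?thesis using r by (simp add: field_simps)
  qed
  have "cnj (p ^ 2 - 1) * (2 * a ^ 2 + 2 * p * b)
      = of_real (m ^ 2 / (2 * r ^ 2)) * (u ^ 2 * (u * cnj u) ^ 4) + of_real (2 * r) * (cnj u ^ 3 * b * (u * cnj u))"
    unfolding wu a' using r by (simp add: pu field_simps power_numeral_reduce)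
  also have "\<dots> = of_real (m ^ 2 / (2 * r ^ 2)) * u ^ 2 + of_real (2 * r) * (cnj u ^ 3 * b)"
    by (simp add: uu)
  finally have "Re (cnj (p ^ 2 - 1) * (2 * a ^ 2 + 2 * p * b))
      = m ^ 2 / (2 * r ^ 2) * Re (u ^ 2) + 2 * r * Re (cnj u ^ 3 * b)"
    by (simp only: plus_complex.sel Re_complex_of_real Im_complex_of_real times_complex.sel mult_zero_left diff_zero)
  \<comment> \<open>The square of \<open>a\<close> uses up exactly one quarter of
    \<open>m^2\<close>. What is left for \<open>b\<close> is \<open>3 / 4 * m ^ 2\<close>, at least
    3 by \<open>m \<ge> 2\<close>; this is the 3 in the final constant.\<close>
  also have "m ^ 2 / (2 * r ^ 2) * Re (u ^ 2) = m ^ 2 / 4" using r by (simp add: Reu2)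
  finally have "2 * r * Re (cnj u ^ 3 * b) \<ge> 3 / 4 * m ^ 2" using b by simp
  moreover have "m ^ 2 \<ge> 2 ^ 2" using m by (intro power_mono) auto
  ultimately have "2 * r * Re (cnj u ^ 3 * b) \<ge> 3" by simp
  then have Reb: "Re (cnj u ^ 3 * b) \<ge> 3 / (2 * r)" using r by (simp add: field_simps)
  \<comment> \<open>The factor \<open>cnj u ^ 3\<close> has modulus 1, so the norm is unchanged,
    while \<open>u ^ 4\<close> becomes \<open>u\<close> and \<open>b\<close> enters in the form
    already bounded by \<open>Reb\<close>.\<close>
  have "Re (cnj u ^ 3 * (p ^ 2 + b - 1)) = Re (u * (u * cnj u) ^ 3 + cnj u ^ 3 * b)"
  proof -
    have "p ^ 2 + b - 1 = u ^ 4 + b" using wu by (simp add: algebra_simps)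
    then show ?thesis by (simp add: algebra_simps power_numeral_reduce)
  qed
  also have "\<dots> \<ge> Re u + 3 / (2 * r)" using Reb by (simp add: uu)
  finally have "Re u + 3 / (2 * r) \<le> norm (cnj u ^ 3 * (p ^ 2 + b - 1))"
    using complex_Re_le_cmod order_trans by blast
  then have "Re u + 3 / (2 * r) \<le> norm (p ^ 2 + b - 1)"
    by (simp add: norm_mult norm_power nu)
  moreover have "Re u + 3 / (2 * r) \<ge> 1 + 3 / (2 * sqrt 2)"
  proof (rule lemniscate_boundary_bound)
    show "0 \<le> Re u" using p r by (simp add: u_def)
    show "Re u \<le> 1" using complex_Re_le_cmod[of u] nu by simp
    have "Re u ^ 2 + Im u ^ 2 = 1" using nu by (simp add: cmod_def)
    then show "4 * Re u ^ 2 = 2 + r ^ 2" using Reu2 by (simp add: power2_eq_square)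
    have "r ^ 2 = norm (1 + (p ^ 2 - 1))" by (simp add: r_def norm_power)
    also have "\<dots> \<le> 2" using norm_triangle_ineq[of 1 "p ^ 2 - 1"] w by simp
    finally show "r \<le> sqrt 2" by (simp add: real_le_rsqrt)
  qed (fact r)
  ultimately show ?thesis by simp
qed

section \<open>From the second-order differential inequality to the lemniscate region\<close>

text \<open>The set \<open>|p^2 - 1| < 1\<close> consists of two loops separated by the imaginary
  axis, where \<open>p^2\<close> is real and at most 0. A connected image stays in the loop of
  \<open>p a\<close>.\<close>

lemma Re_pos_lemniscate:
  fixes p :: "complex \<Rightarrow> complex"
  assumes cont: "continuous_on S p" and S: "connected S" "a \<in> S" "Re (p a) > 0"
    and lt: "\<And>z. z \<in> S \<Longrightarrow> norm (p z ^ 2 - 1) < 1" and z: "z \<in> S"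
  shows "Re (p z) > 0"
proof (rule ccontr)
  assume neg: "\<not> Re (p z) > 0"
  have "connected ((\<lambda>z. Re (p z)) ` S)"
    by (intro connected_continuous_image continuous_intros cont S)
  moreover have "Re (p a) \<in> (\<lambda>z. Re (p z)) ` S" "Re (p z) \<in> (\<lambda>z. Re (p z)) ` S"
    using S z by auto
  ultimately have "0 \<in> (\<lambda>z. Re (p z)) ` S"
    using neg S(3) unfolding connected_iff_interval
    by (metis less_imp_le not_less)
  then obtain y where y: "y \<in> S" "Re (p y) = 0" by auto
  have "Re (p y ^ 2 - 1) = - (Im (p y) ^ 2) - 1" using y by (simp add: power2_eq_square)
  also have "\<dots> \<le> - 1" by simp
  finally have "\<bar>Re (p y ^ 2 - 1)\<bar> \<ge> 1" by linarith
  then show False using lt[OF y(1)] abs_Re_le_cmod[of "p y ^ 2 - 1"] by linarith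
qed

text \<open>Contradiction at a first boundary point \<open>z0\<close>, where
  \<open>Jack_Miller_Mocanu\<close> supplies the hypotheses of \<open>lemniscate_admissible\<close>.
  The point needing separate care is the node \<open>p = 0\<close> of the lemniscate, which lies on
  the curve but has real part 0.\<close>

lemma lemniscate_subordination:
  assumes hol: "p holomorphic_on ball 0 1" and p0: "p 0 = 1" "deriv p 0 = 0"
    and ineq: "\<And>z. norm z < 1 \<Longrightarrow>
      norm (p z ^ 2 + z * deriv p z + z ^ 2 * deriv (deriv p) z - 1) < 1 + 3 / (2 * sqrt 2)"
    and z: "norm z < 1"
  shows "norm (p z ^ 2 - 1) < 1"
proof (rule ccontr)
  assume z_bad: "\<not> norm (p z ^ 2 - 1) < 1"
  define w where "w z = p z ^ 2 - 1" for z
  have holw: "w holomorphic_on ball 0 1" unfolding w_def by (intro holomorphic_intros hol)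
  have cont: "continuous_on (ball 0 1) w" by (rule holomorphic_on_imp_continuous_on[OF holw])
  have pd: "(p has_field_derivative deriv p y) (at y)" if "norm y < 1" for y
    using holomorphic_derivI[OF hol open_ball, of y] that by simp
  have pd2: "(deriv p has_field_derivative deriv (deriv p) y) (at y)" if "norm y < 1" for y
    using holomorphic_derivI[OF holomorphic_deriv[OF hol open_ball] open_ball, of y] that by simp
  have dw: "deriv w y = 2 * p y * deriv p y" if "norm y < 1" for y
    unfolding w_def by (rule DERIV_imp_deriv) (auto intro!: derivative_eq_intros pd that)
  have ddw: "deriv (deriv w) y = 2 * (deriv p y) ^ 2 + 2 * p y * deriv (deriv p) y" if y: "norm y < 1" for y
  proof -
    have "eventually (\<lambda>z. z \<in> ball 0 1) (nhds y)"
      using y by (intro eventually_nhds_in_open) auto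
    then have "eventually (\<lambda>z. deriv w z = 2 * p z * deriv p z) (nhds y)"
      by eventually_elim (simp add: dw)
    then have "deriv (deriv w) y = deriv (\<lambda>z. 2 * p z * deriv p z) y"
      by (intro deriv_cong_ev) auto
    also have "\<dots> = 2 * (deriv p y) ^ 2 + 2 * p y * deriv (deriv p) y"
      by (rule DERIV_imp_deriv)
         (auto intro!: derivative_eq_intros pd pd2 y simp: algebra_simps power2_eq_square)
    finally show ?thesis .
  qed
  \<comment> \<open>The compact set of bad points of modulus at most \<open>|z|\<close>; a point of
    least modulus in it has \<open>|w| < 1\<close> on the whole open disc up to it.\<close>
  define K where "K = cball 0 (norm z) \<inter> (\<lambda>y. norm (w y)) -` {1..}"
  have sub: "cball 0 (norm z) \<subseteq> ball 0 1" using z by auto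
  have "closed K" unfolding K_def
    by (intro continuous_closed_preimage)
       (auto intro!: continuous_intros continuous_on_subset[OF cont sub])
  then have "compact K"
    using bounded_subset[OF bounded_cball] by (auto simp: compact_eq_bounded_closed K_def)
  moreover have "z \<in> K" using z_bad by (simp add: K_def w_def)
  ultimately obtain z0 where z0: "z0 \<in> K" "\<And>y. y \<in> K \<Longrightarrow> norm z0 \<le> norm y"
    using continuous_attains_inf[of K norm] by (auto intro: continuous_intros)
  have n0: "norm z0 < 1" and ge: "norm (w z0) \<ge> 1" using z0(1) z by (auto simp: K_def)
  have lt: "norm (w y) < 1" if "norm y < norm z0" for y
    using z0(2)[of y] z0(1) that by (fastforce simp: K_def)
  have "w 0 = 0" by (simp add: w_def p0)
  then have nz: "z0 \<noteq> 0" using ge by auto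
  have clos: "z0 \<in> closure (ball 0 (norm z0))" "closure (ball 0 (norm z0)) \<subseteq> ball (0 :: complex) 1"
    using nz n0 by auto
  have "norm (w z0) \<le> 1"
    using lt clos by (intro continuous_on_closure_norm_le[OF continuous_on_subset[OF cont]])
      (auto intro: less_imp_le)
  then have w1: "norm (w z0) = 1" using ge by simp
  have contp: "continuous_on (ball 0 1) p" by (rule holomorphic_on_imp_continuous_on[OF hol])
  have Re_inside: "Re (p y) > 0" if "y \<in> ball 0 (norm z0)" for y
  proof (rule Re_pos_lemniscate[of "ball 0 (norm z0)" p 0])
    show "continuous_on (ball 0 (norm z0)) p"
      by (rule continuous_on_subset[OF contp]) (use n0 in auto)
    show "norm (p x ^ 2 - 1) < 1" if "x \<in> ball 0 (norm z0)" for x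
      using lt[of x] that by (simp add: w_def)
  qed (use that nz p0 in auto)
  have Re_ge: "Re (p z0) \<ge> 0"
  proof (rule continuous_ge_on_closure[of "ball 0 (norm z0)" "\<lambda>z. Re (p z)"])
    show "continuous_on (closure (ball 0 (norm z0))) (\<lambda>z. Re (p z))"
      by (intro continuous_intros continuous_on_subset[OF contp] clos)
  qed (use clos Re_inside in \<open>auto intro: less_imp_le\<close>)
  obtain m where m: "m \<ge> 2" "z0 * deriv w z0 = of_real m * w z0"
    "Re (cnj (w z0) * (z0 * deriv w z0 + z0 ^ 2 * deriv (deriv w) z0)) \<ge> m ^ 2"
  proof (rule Jack_Miller_Mocanu[OF holw \<open>w 0 = 0\<close> _ n0 w1 lt])
    show "deriv w 0 = 0" by (simp add: dw p0)
  qed auto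
  \<comment> \<open>At the node the derivative of \<open>p^2\<close> would vanish, whereas
    \<open>z0 * deriv w z0\<close> has modulus \<open>m \<ge> 2\<close>.\<close>
  have "p z0 \<noteq> 0" using m(1,2) w1 n0 by (auto simp: dw)
  have Re_pos: "Re (p z0) > 0"
  proof (rule ccontr)
    assume "\<not> Re (p z0) > 0"
    then have "Re (p z0) = 0" using Re_ge by simp
    then have "w z0 = - of_real (Im (p z0) ^ 2 + 1)" "Im (p z0) \<noteq> 0"
      using \<open>p z0 \<noteq> 0\<close> by (auto simp: w_def complex_eq_iff power2_eq_square)
    then have "norm (w z0) = Im (p z0) ^ 2 + 1" "Im (p z0) \<noteq> 0"
      by (auto simp del: of_real_add)
    then show False using w1 by simp
  qed
  have "norm (p z0 ^ 2 + (z0 * deriv p z0 + z0 ^ 2 * deriv (deriv p) z0) - 1) \<ge> 1 + 3 / (2 * sqrt 2)"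
  proof (rule lemniscate_admissible[OF Re_pos _ m(1)])
    show "norm (p z0 ^ 2 - 1) = 1" using w1 by (simp add: w_def)
    show "2 * p z0 * (z0 * deriv p z0) = of_real m * (p z0 ^ 2 - 1)"
      using m(2) by (simp add: dw n0 w_def mult_ac)
    have "z0 * deriv w z0 + z0 ^ 2 * deriv (deriv w) z0 =
        2 * (z0 * deriv p z0) ^ 2 + 2 * p z0 * (z0 * deriv p z0 + z0 ^ 2 * deriv (deriv p) z0)"
      by (simp add: dw ddw n0 algebra_simps power2_eq_square)
    then show "m ^ 2 \<le> Re (cnj (p z0 ^ 2 - 1) *
        (2 * (z0 * deriv p z0) ^ 2 + 2 * p z0 * (z0 * deriv p z0 + z0 ^ 2 * deriv (deriv p) z0)))"
      using m(3) by (simp only: w_def)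
  qed
  then show False using ineq[OF n0] by (simp add: add.assoc)
qed

section \<open>Derivatives of the quotient \<open>z f' / f\<close>\<close>

lemma deriv_quotient:
  fixes u v :: "complex \<Rightarrow> complex"
  assumes hol: "u holomorphic_on S" "v holomorphic_on S" and S: "open S" "z \<in> S" "v z \<noteq> 0"
  shows "deriv (\<lambda>z. u z / v z) z = (deriv u z * v z - u z * deriv v z) / v z ^ 2"
  using holomorphic_derivI[OF hol(1) S(1,2), of UNIV] holomorphic_derivI[OF hol(2) S(1,2), of UNIV] S(3)
  by (intro DERIV_imp_deriv) (auto intro!: derivative_eq_intros simp: power2_eq_square)

lemma deriv_deriv_quotient:
  fixes u v :: "complex \<Rightarrow> complex"
  assumes hol: "u holomorphic_on S" "v holomorphic_on S" and S: "open S" "z \<in> S"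
    and nz: "\<And>z. z \<in> S \<Longrightarrow> v z \<noteq> 0"
  shows "deriv (deriv (\<lambda>z. u z / v z)) z =
    deriv (deriv u) z / v z - 2 * deriv u z * deriv v z / v z ^ 2
    - u z * deriv (deriv v) z / v z ^ 2 + 2 * u z * deriv v z ^ 2 / v z ^ 3"
proof -
  have "eventually (\<lambda>z. z \<in> S) (nhds z)"
    using S by (rule eventually_nhds_in_open)
  then have "eventually (\<lambda>z. deriv (\<lambda>z. u z / v z) z = (deriv u z * v z - u z * deriv v z) / v z ^ 2) (nhds z)"
    by eventually_elim (intro deriv_quotient[OF hol S(1)] nz)
  then have "deriv (deriv (\<lambda>z. u z / v z)) z =
      deriv (\<lambda>z. (deriv u z * v z - u z * deriv v z) / v z ^ 2) z"
    by (intro deriv_cong_ev) auto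
  also have "\<dots> = deriv (deriv u) z / v z - 2 * deriv u z * deriv v z / v z ^ 2
    - u z * deriv (deriv v) z / v z ^ 2 + 2 * u z * deriv v z ^ 2 / v z ^ 3"
  proof (rule DERIV_imp_deriv)
    define N where "N z = deriv u z * v z - u z * deriv v z" for z
    note d = holomorphic_derivI[OF hol(1) S, of UNIV] holomorphic_derivI[OF hol(2) S, of UNIV]
      holomorphic_derivI[OF holomorphic_deriv[OF hol(1) S(1)] S, of UNIV]
      holomorphic_derivI[OF holomorphic_deriv[OF hol(2) S(1)] S, of UNIV]
    have "(N has_field_derivative deriv (deriv u) z * v z - u z * deriv (deriv v) z) (at z)"
      unfolding N_def using d by (auto intro!: derivative_eq_intros)
    from DERIV_divide[OF this DERIV_power[OF d(2), of 2]]
    have N: "((\<lambda>z. N z / v z ^ 2) has_field_derivative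
        ((deriv (deriv u) z * v z - u z * deriv (deriv v) z) * v z ^ 2 - N z * (2 * v z * deriv v z))
          / (v z ^ 2 * v z ^ 2)) (at z)"
      using nz[OF S(2)] by (simp add: mult_ac)
    have "(a * v - u * b) * v ^ 2 - (c * v - u * d) * (2 * v * d)
        = (a / v - 2 * c * d / v ^ 2 - u * b / v ^ 2 + 2 * u * d ^ 2 / v ^ 3) * (v ^ 2 * v ^ 2)"
      if "v \<noteq> 0" for a b c d u v :: complex
      using that by (simp add: field_simps power2_eq_square power3_eq_cube)
    from this[OF nz[OF S(2)]] show "((\<lambda>z. (deriv u z * v z - u z * deriv v z) / v z ^ 2)
        has_field_derivative deriv (deriv u) z / v z - 2 * deriv u z * deriv v z / v z ^ 2
          - u z * deriv (deriv v) z / v z ^ 2 + 2 * u z * deriv v z ^ 2 / v z ^ 3) (at z)"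
      using N nz[OF S(2)] unfolding N_def by simp
  qed
  finally show ?thesis .
qed

text \<open>The three summands agree one by one with \<open>q^2\<close>, \<open>z q'\<close> and
  \<open>z^2 q''\<close>. Nonvanishing of \<open>deriv f z\<close> is what lets the factors
  \<open>f'\<close> in the left-hand side cancel.\<close>

lemma starlike_quotient_expression:
  assumes hol: "f holomorphic_on S" and S: "open S" "z \<in> S"
    and nz: "\<And>z. z \<in> S \<Longrightarrow> f z \<noteq> 0" and nz': "deriv f z \<noteq> 0"
  defines "q \<equiv> \<lambda>z. z * deriv f z / f z"
  shows "(z * deriv f z / f z)^2
           + z * deriv f z / f z * (1 + z * deriv (deriv f) z / deriv f z - z * deriv f z / f z)
           + z * deriv f z / f z *
               (z^2 * deriv (deriv (deriv f)) z / deriv f z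
                - 3 * z^2 * deriv (deriv f) z / f z
                + 2 * z * deriv (deriv f) z / deriv f z
                + 2 * (z * deriv f z / f z)^2
                - 2 * z * deriv f z / f z)
         = q z ^ 2 + z * deriv q z + z ^ 2 * deriv (deriv q) z"
proof -
  define u where "u z = z * deriv f z" for z
  note hol1 = holomorphic_deriv[OF hol S(1)]
  note hol2 = holomorphic_deriv[OF hol1 S(1)]
  have holu: "u holomorphic_on S" unfolding u_def by (intro holomorphic_intros hol1)
  have u1: "deriv u y = deriv f y + y * deriv (deriv f) y" if "y \<in> S" for y
    unfolding u_def using holomorphic_derivI[OF hol1 S(1) that, of UNIV]
    by (intro DERIV_imp_deriv) (auto intro!: derivative_eq_intros)
  have "eventually (\<lambda>z. z \<in> S) (nhds z)"
    using S by (rule eventually_nhds_in_open)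
  then have "eventually (\<lambda>z. deriv u z = deriv f z + z * deriv (deriv f) z) (nhds z)"
    by eventually_elim (rule u1)
  then have "deriv (deriv u) z = deriv (\<lambda>z. deriv f z + z * deriv (deriv f) z) z"
    by (intro deriv_cong_ev) auto
  also have "\<dots> = 2 * deriv (deriv f) z + z * deriv (deriv (deriv f)) z"
    using holomorphic_derivI[OF hol1 S, of UNIV] holomorphic_derivI[OF hol2 S, of UNIV]
    by (intro DERIV_imp_deriv) (auto intro!: derivative_eq_intros)
  finally have u2: "deriv (deriv u) z = 2 * deriv (deriv f) z + z * deriv (deriv (deriv f)) z" .
  have q: "q = (\<lambda>z. u z / f z)" by (simp add: q_def u_def)
  have q1: "deriv q z = ((deriv f z + z * deriv (deriv f) z) * f z - z * deriv f z * deriv f z) / f z ^ 2"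
    unfolding q deriv_quotient[OF holu hol S nz[OF S(2)]] u1[OF S(2)] by (simp add: u_def)
  have q2: "deriv (deriv q) z = (2 * deriv (deriv f) z + z * deriv (deriv (deriv f)) z) / f z
      - 2 * (deriv f z + z * deriv (deriv f) z) * deriv f z / f z ^ 2
      - z * deriv f z * deriv (deriv f) z / f z ^ 2 + 2 * (z * deriv f z) * deriv f z ^ 2 / f z ^ 3"
    using deriv_deriv_quotient[OF holu hol S] nz unfolding q u1[OF S(2)] u2 by (simp add: u_def)
  \<comment> \<open>Measuring the derivatives of \<open>f\<close> in units of \<open>f z\<close>
    turns \<open>q\<close>, \<open>q'\<close> and \<open>q''\<close> into polynomials in
    \<open>z\<close>, \<open>L\<close>, \<open>M\<close>, \<open>N\<close>.\<close>
  define c where "c = f z"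
  define L where "L = deriv f z / c"
  define M where "M = deriv (deriv f) z / c"
  define N where "N = deriv (deriv (deriv f)) z / c"
  have c: "c \<noteq> 0" "L \<noteq> 0" using nz[OF S(2)] nz' by (auto simp: c_def L_def)
  have d: "f z = c" "deriv f z = L * c" "deriv (deriv f) z = M * c" "deriv (deriv (deriv f)) z = N * c"
    using c by (auto simp: c_def L_def M_def N_def)
  have q0: "q z = z * L" using c by (simp add: q_def d)
  have q1': "deriv q z = L + z * M - z * L ^ 2"
    unfolding q1 d using c by (simp add: field_simps power2_eq_square)
  have q2': "deriv (deriv q) z = 2 * M + z * N - 2 * (L + z * M) * L - z * L * M + 2 * z * L ^ 3"
    unfolding q2 d using c by (simp add: field_simps power2_eq_square power3_eq_cube)
  have e: "z * (L * c) / c = z * L" "z * (M * c) / (L * c) = z * M / L" "x * (M * c) / c = x * M"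
    "x * (M * c) / (L * c) = x * M / L" "x * (N * c) / (L * c) = x * N / L" for x
    using c by auto
  show ?thesis
    unfolding q0 q1' q2' d e using c
    by (simp add: field_simps power2_eq_square power3_eq_cube)
qed

section \<open>Exclusion of zeros of \<open>f\<close> away from the origin\<close>

lemma simple_pole_contradiction:
  fixes A H p :: "complex \<Rightarrow> complex"
  assumes hol: "A holomorphic_on S" and S: "open S" "a \<in> S" and nz: "A a \<noteq> 0" "a \<noteq> 0"
    and p: "\<And>z. z \<in> S - {a} \<Longrightarrow> p z = A z / (z - a)"
    and H: "isCont H a"
    and eq: "eventually (\<lambda>z. H z = p z ^ 2 + z * deriv p z + z ^ 2 * deriv (deriv p) z) (at a)"
  shows False
proof -
  let ?q = "\<lambda>z. A z / (z - a)"
  \<comment> \<open>\<open>G\<close> is \<open>(z - a)^3\<close> times the expression for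
    \<open>A / (z - a)\<close>, with all denominators cleared. It is continuous at \<open>a\<close>,
    and only the triple pole of the second derivative survives there:
    \<open>G a = 2 a^2 A a\<close>, which is nonzero. Against this, \<open>(z - a)^3 * H z\<close>
    tends to 0.\<close>
  define G where "G z = A z ^ 2 * (z - a) + z * (deriv A z * (z - a) ^ 2 - A z * (z - a))
    + z ^ 2 * (deriv (deriv A) z * (z - a) ^ 2 - 2 * deriv A z * (z - a) + 2 * A z)" for z
  have op: "open (S - {a})" using S(1) by (simp add: open_delete)
  note hol1 = holomorphic_deriv[OF hol S(1)]
  note hol2 = holomorphic_deriv[OF hol1 S(1)]
  have holp: "A holomorphic_on S - {a}" by (rule holomorphic_on_subset[OF hol]) auto
  have holv: "(\<lambda>z. z - a) holomorphic_on S - {a}" by (intro holomorphic_intros)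
  have dv: "deriv (\<lambda>z. z - a) = (\<lambda>z. 1)"
    by (intro ext DERIV_imp_deriv) (auto intro!: derivative_eq_intros)
  have key: "(z - a) ^ 3 * (p z ^ 2 + z * deriv p z + z ^ 2 * deriv (deriv p) z) = G z"
    if z: "z \<in> S - {a}" for z
  proof -
    have ev: "eventually (\<lambda>z. z \<in> S - {a}) (nhds y)" if "y \<in> S - {a}" for y
      using op that by (rule eventually_nhds_in_open)
    have eq1: "deriv p y = deriv ?q y" if y: "y \<in> S - {a}" for y
    proof (rule deriv_cong_ev)
      show "eventually (\<lambda>z. p z = ?q z) (nhds y)"
        using ev[OF y] by eventually_elim (rule p)
    qed simp
    have "deriv (deriv p) z = deriv (deriv ?q) z"
    proof (rule deriv_cong_ev)
      show "eventually (\<lambda>z. deriv p z = deriv ?q z) (nhds z)"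
        using ev[OF z] by eventually_elim (rule eq1)
    qed simp
    also have "\<dots> = deriv (deriv A) z / (z - a) - 2 * deriv A z / (z - a) ^ 2 + 2 * A z / (z - a) ^ 3"
      using deriv_deriv_quotient[OF holp holv op z] by (simp add: dv)
    finally have p2: "deriv (deriv p) z = deriv (deriv A) z / (z - a) - 2 * deriv A z / (z - a) ^ 2 + 2 * A z / (z - a) ^ 3" .
    have p1: "deriv p z = (deriv A z * (z - a) - A z) / (z - a) ^ 2"
      using eq1[OF z] deriv_quotient[OF holp holv op z] z by (simp add: dv)
    define d where "d = z - a"
    have d: "d \<noteq> 0" using z by (simp add: d_def)
    have "d ^ 3 * ((b / d) ^ 2 + z * ((b' * d - b) / d ^ 2) + z ^ 2 * (b'' / d - 2 * b' / d ^ 2 + 2 * b / d ^ 3))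
        = b ^ 2 * d + z * (b' * d ^ 2 - b * d) + z ^ 2 * (b'' * d ^ 2 - 2 * b' * d + 2 * b)" for b b' b''
    proof -
      have "d ^ 3 * (b / d) ^ 2 = b ^ 2 * d" "d ^ 3 * (b'' / d) = b'' * d ^ 2"
        "d ^ 3 * ((b' * d - b) / d ^ 2) = b' * d ^ 2 - b * d"
        "d ^ 3 * (2 * b' / d ^ 2) = 2 * b' * d" "d ^ 3 * (2 * b / d ^ 3) = 2 * b"
        using d by (simp_all add: field_simps power2_eq_square power3_eq_cube)
      moreover have "c * (r + z * s + z ^ 2 * (x - y + t)) = c * r + z * (c * s) + z ^ 2 * (c * x - c * y + c * t)"
        for c r s x y t :: complex
        by (simp add: algebra_simps)
      ultimately show ?thesis by (simp only:)
    qed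
    then show ?thesis unfolding p1 p2 p[OF z] G_def d_def .
  qed
  have c: "isCont A a" "isCont (deriv A) a" "isCont (deriv (deriv A)) a"
    using hol hol1 hol2 S by (auto intro: continuous_on_interior holomorphic_on_imp_continuous_on simp: interior_open)
  have "isCont G a" unfolding G_def by (intro continuous_intros c)
  then have "G \<midarrow>a\<rightarrow> G a" by (simp add: isCont_def)
  have "isCont (\<lambda>z. (z - a) ^ 3 * H z) a" by (intro continuous_intros H)
  then have "(\<lambda>z. (z - a) ^ 3 * H z) \<midarrow>a\<rightarrow> (a - a) ^ 3 * H a" by (simp only: isCont_def)
  have "eventually (\<lambda>z. (z - a) ^ 3 * H z = G z) (at a)"
  proof -
    have "eventually (\<lambda>z. z \<in> S - {a}) (at a)"
      using S by (rule eventually_at_in_open)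
    with eq show ?thesis by eventually_elim (simp add: key)
  qed
  then have "G \<midarrow>a\<rightarrow> (a - a) ^ 3 * H a"
    using \<open>(\<lambda>z. (z - a) ^ 3 * H z) \<midarrow>a\<rightarrow> (a - a) ^ 3 * H a\<close> by (rule Lim_transform_eventually[rotated])
  with \<open>G \<midarrow>a\<rightarrow> G a\<close> have "G a = (a - a) ^ 3 * H a"
    using LIM_unique by blast
  then show False using nz by (simp add: G_def)
qed

text \<open>Writing \<open>f z = (z - a)^n * g z\<close> with zero-free \<open>g\<close>, the
  logarithmic derivative is \<open>n / (z - a)\<close> plus a holomorphic term. Hence
  \<open>A a = n a\<close>, nonzero since \<open>a\<close> is.\<close>

lemma log_derivative_simple_pole:
  assumes hol: "f holomorphic_on S" and S: "open S" "connected S" "a \<in> S"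
    and fa: "f a = 0" "a \<noteq> 0" and nonconst: "\<not> f constant_on S"
  obtains A r where "r > 0" "ball a r \<subseteq> S" "A holomorphic_on ball a r" "A a \<noteq> 0"
    "\<And>z. z \<in> ball a r - {a} \<Longrightarrow> z * deriv f z / f z = A z / (z - a)"
proof -
  obtain g r n where g: "0 < n" "0 < r" "ball a r \<subseteq> S" "g holomorphic_on ball a r"
      "\<And>w. w \<in> ball a r \<Longrightarrow> f w = (w - a) ^ n * g w" "\<And>w. w \<in> ball a r \<Longrightarrow> g w \<noteq> 0"
    using holomorphic_factor_zero_nonconstant[OF hol S fa(1) nonconst] by metis
  define A where "A z = z * (of_nat n + (z - a) * deriv g z / g z)" for z
  show thesis
  proof (rule that[of r A])
    show "A holomorphic_on ball a r"
      unfolding A_def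
      by (intro holomorphic_intros holomorphic_deriv[OF g(4)] g(4)) (simp_all add: g(6))
    show "A a \<noteq> 0" using fa g(1) by (simp add: A_def)
    fix z assume z: "z \<in> ball a r - {a}"
    have "eventually (\<lambda>z. z \<in> ball a r) (nhds z)"
      using z by (intro eventually_nhds_in_open) auto
    then have "eventually (\<lambda>z. f z = (z - a) ^ n * g z) (nhds z)"
      by eventually_elim (rule g(5))
    then have "deriv f z = deriv (\<lambda>z. (z - a) ^ n * g z) z"
      by (intro deriv_cong_ev) auto
    also have "\<dots> = of_nat n * (z - a) ^ (n - 1) * g z + (z - a) ^ n * deriv g z"
      using holomorphic_derivI[OF g(4) open_ball, of z UNIV] z
      by (intro DERIV_imp_deriv) (auto intro!: derivative_eq_intros)
    finally have df: "deriv f z = of_nat n * (z - a) ^ (n - 1) * g z + (z - a) ^ n * deriv g z" .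
    obtain k where k: "n = Suc k" using g(1) by (cases n) auto
    show "z * deriv f z / f z = A z / (z - a)"
    proof -
      have "z * (c * e * h + d * e * h') / (d * e * h) = z * (c + d * h' / h) / d"
        if "d \<noteq> 0" "e \<noteq> 0" "h \<noteq> 0" for c d e h h' :: complex
        using that by (simp add: field_simps)
      from this[of "z - a" "(z - a) ^ k" "g z" "of_nat n" "deriv g z"] show ?thesis
        using z g(5,6)[of z] unfolding df A_def k by simp
    qed
  qed (use g in auto)
qed

section \<open>Removal of singularities and passage to \<open>class_SL\<close>\<close>

theorem theorem4p4:
  fixes f :: "complex \<Rightarrow> complex" and P :: "complex fps"
  assumes "f \<in> class_A"
    and "starlike_quotient f has_fps_expansion P"
    and "fps_nth P 0 = 1" and "fps_nth P 1 = 0"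
    and "remove_sings (\<lambda>z.
           (z * deriv f z / f z)^2
           + z * deriv f z / f z * (1 + z * deriv (deriv f) z / deriv f z - z * deriv f z / f z)
           + z * deriv f z / f z *
               (z^2 * deriv (deriv (deriv f)) z / deriv f z
                - 3 * z^2 * deriv (deriv f) z / f z
                + 2 * z * deriv (deriv f) z / deriv f z
                + 2 * (z * deriv f z / f z)^2
                - 2 * z * deriv f z / f z))
         \<prec>\<^sub>s (\<lambda>z. 1 + of_real (1 + 3 / (2 * sqrt 2)) * z)"
  shows "f \<in> class_SL"
proof -
  \<comment> \<open>\<open>E\<close> and \<open>q\<close> are the plain quotients, \<open>H\<close>
    and \<open>p\<close> the same with singularities removed. On \<open>V\<close> no denominator
    vanishes, so there the plain formulas are the intended ones.\<close>
  define E where "E = (\<lambda>z.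
           (z * deriv f z / f z)^2
           + z * deriv f z / f z * (1 + z * deriv (deriv f) z / deriv f z - z * deriv f z / f z)
           + z * deriv f z / f z *
               (z^2 * deriv (deriv (deriv f)) z / deriv f z
                - 3 * z^2 * deriv (deriv f) z / f z
                + 2 * z * deriv (deriv f) z / deriv f z
                + 2 * (z * deriv f z / f z)^2
                - 2 * z * deriv f z / f z))"
  define H where "H = remove_sings E"
  define q where "q z = z * deriv f z / f z" for z
  define p where "p = starlike_quotient f"
  define V where "V = {z \<in> ball 0 1. f z \<noteq> 0 \<and> deriv f z \<noteq> 0}"
  have f: "f holomorphic_on ball 0 1" "f 0 = 0" "deriv f 0 = 1"
    using assms(1) by (auto simp: class_A_def)
  note f1 = holomorphic_deriv[OF f(1) open_ball]
  have sub: "H \<prec>\<^sub>s (\<lambda>z. 1 + of_real (1 + 3 / (2 * sqrt 2)) * z)"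
    using assms(5) unfolding H_def E_def .
  then have holH: "H holomorphic_on ball 0 1" by (simp add: subordinate_def)
  have nonconst: "\<not> f constant_on ball 0 1"
  proof
    assume "f constant_on ball 0 1"
    then obtain c where c: "\<And>z. z \<in> ball 0 1 \<Longrightarrow> f z = c" by (auto simp: constant_on_def)
    have "eventually (\<lambda>z. z \<in> ball 0 1) (nhds (0::complex))"
      by (intro eventually_nhds_in_open) auto
    then have "eventually (\<lambda>z. f z = c) (nhds 0)"
      by eventually_elim (rule c)
    then have "deriv f 0 = deriv (\<lambda>z. c) 0" by (intro deriv_cong_ev) auto
    then show False using f(3) by simp
  qed
  then obtain b where b: "b \<in> ball 0 1" "f b \<noteq> 0"
    unfolding constant_on_def by metis
  \<comment> \<open>Zeros of \<open>f\<close> and of \<open>deriv f\<close> are isolated, as neither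
    function vanishes identically: \<open>b\<close> and 0 are witnesses.\<close>
  have ev_V: "eventually (\<lambda>z. z \<in> V) (at a)" if "a \<in> ball 0 1" for a
    using non_zero_neighbour_alt[OF f(1) open_ball connected_ball that b]
      non_zero_neighbour_alt[OF f1 open_ball connected_ball that, of 0] f(3)
    by (auto simp: V_def eventually_conj_iff elim: eventually_elim2)
  have "open V"
  proof -
    have "V = ball 0 1 \<inter> (\<lambda>z. f z * deriv f z) -` (- {0})" by (auto simp: V_def)
    moreover have "open \<dots>"
      using holomorphic_on_mult[OF f(1) f1]
      by (intro continuous_open_preimage holomorphic_on_imp_continuous_on) auto
    ultimately show ?thesis by simp
  qed
  have fV: "f holomorphic_on V"
    by (rule holomorphic_on_subset[OF f(1)]) (auto simp: V_def)
  note fV1 = holomorphic_deriv[OF fV \<open>open V\<close>]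
  note fV2 = holomorphic_deriv[OF fV1 \<open>open V\<close>]
  note fV3 = holomorphic_deriv[OF fV2 \<open>open V\<close>]
  have HV: "H z = q z ^ 2 + z * deriv q z + z ^ 2 * deriv (deriv q) z" if z: "z \<in> V" for z
  proof -
    have "E holomorphic_on V" unfolding E_def
      by (intro fV fV1 fV2 fV3 holomorphic_on_add holomorphic_on_mult holomorphic_on_divide holomorphic_on_diff
            holomorphic_on_power holomorphic_on_const holomorphic_on_ident) (auto simp: V_def)
    then have "E analytic_on {z}"
      using \<open>open V\<close> z analytic_at by blast
    then have "H z = E z" by (simp add: H_def)
    also have "\<dots> = q z ^ 2 + z * deriv q z + z ^ 2 * deriv (deriv q) z"
      unfolding E_def q_def using z
      by (intro starlike_quotient_expression[OF fV \<open>open V\<close>]) (auto simp: V_def)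
    finally show ?thesis .
  qed
  have nz: "f a \<noteq> 0" if a: "a \<in> ball 0 1" "a \<noteq> 0" for a
  proof
    assume "f a = 0"
    then obtain A r where A: "r > 0" "ball a r \<subseteq> ball 0 1" "A holomorphic_on ball a r" "A a \<noteq> 0"
      "\<And>z. z \<in> ball a r - {a} \<Longrightarrow> q z = A z / (z - a)"
      using log_derivative_simple_pole[OF f(1) open_ball connected_ball a(1) \<open>f a = 0\<close> a(2) nonconst, folded q_def]
      by metis
    show False
    proof (rule simple_pole_contradiction[OF A(3) open_ball _ A(4) a(2) A(5)])
      \<comment> \<open>Subordination makes \<open>H\<close> holomorphic on the disc, so it cannot
        have the triple pole that a zero of \<open>f\<close> would cause.\<close>
      show "isCont H a"
        using holH a(1) by (simp add: analytic_at_imp_isCont analytic_on_open analytic_on_subset[of H "ball 0 1"])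
      show "eventually (\<lambda>z. H z = q z ^ 2 + z * deriv q z + z ^ 2 * deriv (deriv q) z) (at a)"
        using ev_V[OF a(1)] by eventually_elim (rule HV)
    qed (use A(1) in auto)
  qed
  define D where "D = ball (0::complex) 1 - {0}"
  have "open D" by (simp add: D_def open_delete)
  have qD: "q analytic_on D"
  proof -
    have "f holomorphic_on D" by (rule holomorphic_on_subset[OF f(1)]) (auto simp: D_def)
    then have "q holomorphic_on D" unfolding q_def
      using \<open>open D\<close> by (intro holomorphic_intros) (auto simp: D_def nz)
    then show ?thesis using \<open>open D\<close> by (simp add: analytic_on_open)
  qed
  have p_eq: "p = remove_sings q" by (simp add: p_def starlike_quotient_def q_def[abs_def])
  have pq: "p z = q z" if "z \<in> D" for z
    unfolding p_eq using qD that by (intro remove_sings_at_analytic) (auto intro: analytic_on_subset)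
  have "p analytic_on D" unfolding p_eq by (rule remove_sings_analytic_on[OF qD])
  \<comment> \<open>Off the origin \<open>p\<close> is analytic because \<open>f\<close> has no
    zeros there; at the origin this follows from the power series \<open>P\<close>.\<close>
  moreover have exp: "p has_fps_expansion P" using assms(2) by (simp add: p_def)
  then have "p analytic_on {0}" by (rule has_fps_expansion_imp_analytic_0)
  ultimately have "p analytic_on (D \<union> {0})" by (simp only: analytic_on_Un)
  moreover have "D \<union> {0} = ball 0 1" by (auto simp: D_def)
  ultimately have holp: "p holomorphic_on ball 0 1" by (simp add: analytic_imp_holomorphic)
  note p1 = holomorphic_deriv[OF holp open_ball]
  note p2 = holomorphic_deriv[OF p1 open_ball]
  have p0: "p 0 = 1"
    using has_fps_expansion_imp_0_eq_fps_nth_0[OF exp] assms(3) by simp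
  have dp0: "deriv p 0 = 0"
    using has_fps_expansion_imp_0_eq_fps_nth_0[OF has_fps_expansion_deriv[OF exp]] assms(4) by simp
  \<comment> \<open>\<open>V\<close> omits the origin and any zeros of \<open>deriv f\<close>. Both
    sides are holomorphic on the disc, so the identity theorem carries the equation over to those
    points.\<close>
  have H_eq: "H z = p z ^ 2 + z * deriv p z + z ^ 2 * deriv (deriv p) z" if "z \<in> ball 0 1" for z
  proof (rule analytic_continuation_open[OF \<open>open V\<close> open_ball _ connected_ball _ holH _ _ that])
    show "V \<noteq> {}"
      using eventually_happens[OF ev_V[of 0]] by auto
    show "V \<subseteq> ball 0 1" by (auto simp: V_def)
    show "(\<lambda>z. p z ^ 2 + z * deriv p z + z ^ 2 * deriv (deriv p) z) holomorphic_on ball 0 1"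
      by (intro holomorphic_intros holp p1 p2)
    fix z assume z: "z \<in> V"
    have ev: "eventually (\<lambda>z. z \<in> D) (nhds y)" if "y \<in> D" for y
      using \<open>open D\<close> that by (rule eventually_nhds_in_open)
    have zD: "z \<in> D" using z f(2) by (auto simp: V_def D_def)
    have d1: "deriv p y = deriv q y" if y: "y \<in> D" for y
    proof (rule deriv_cong_ev)
      show "eventually (\<lambda>z. p z = q z) (nhds y)"
        using ev[OF y] by eventually_elim (rule pq)
    qed simp
    have d2: "deriv (deriv p) z = deriv (deriv q) z"
    proof (rule deriv_cong_ev)
      show "eventually (\<lambda>z. deriv p z = deriv q z) (nhds z)"
        using ev[OF zD] by eventually_elim (rule d1)
    qed simp
    show "H z = p z ^ 2 + z * deriv p z + z ^ 2 * deriv (deriv p) z"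
      using HV[OF z] by (simp add: pq[OF zD] d1[OF zD] d2)
  qed
  obtain w where w: "w ` ball 0 1 \<subseteq> ball 0 1"
      "\<And>z. z \<in> ball 0 1 \<Longrightarrow> H z = 1 + of_real (1 + 3 / (2 * sqrt 2)) * w z"
    using sub unfolding subordinate_def by blast
  have lt: "norm (p z ^ 2 - 1) < 1" if "z \<in> ball 0 1" for z
  proof (rule lemniscate_subordination[OF holp p0 dp0])
    fix y :: complex assume "norm y < 1"
    then have y: "y \<in> ball 0 1" by simp
    have c: "1 + 3 / (2 * sqrt 2) > 0" by (simp add: add_pos_pos)
    have "p y ^ 2 + y * deriv p y + y ^ 2 * deriv (deriv p) y - 1 = of_real (1 + 3 / (2 * sqrt 2)) * w y"
      unfolding H_eq[OF y, symmetric] w(2)[OF y] by simp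
    then have "norm (p y ^ 2 + y * deriv p y + y ^ 2 * deriv (deriv p) y - 1) = (1 + 3 / (2 * sqrt 2)) * norm (w y)"
      using c by (simp only: norm_mult norm_of_real abs_of_pos)
    also have "\<dots> < (1 + 3 / (2 * sqrt 2)) * 1"
    proof (rule mult_strict_left_mono[OF _ c])
      have "w y \<in> ball 0 1" using w(1) y by blast
      then show "norm (w y) < 1" by simp
    qed
    finally show "norm (p y ^ 2 + y * deriv p y + y ^ 2 * deriv (deriv p) y - 1) < 1 + 3 / (2 * sqrt 2)"
      by simp
  qed (use that in simp)
  have Re_p: "Re (p z) > 0" if "z \<in> ball 0 1" for z
  proof (rule Re_pos_lemniscate[OF holomorphic_on_imp_continuous_on[OF holp] connected_ball])
    show "0 \<in> ball (0::complex) 1" "Re (p 0) > 0" by (simp_all add: p0)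
  qed (fact lt that)+
  have "p \<prec>\<^sub>s (\<lambda>z. csqrt (1 + z))"
    unfolding subordinate_def
  \<comment> \<open>The Schwarz function is forced: \<open>p = csqrt (1 + w)\<close> means
    \<open>w = p^2 - 1\<close>. Positivity of \<open>Re p\<close> selects the principal
    root.\<close>
  proof (intro conjI exI[of _ "\<lambda>z. p z ^ 2 - 1"] ballI)
    show "(\<lambda>z. csqrt (1 + z)) holomorphic_on ball 0 1"
    proof (intro holomorphic_intros)
      fix z :: complex assume "z \<in> ball 0 1"
      then have "Re (1 + z) > 0" using abs_Re_le_cmod[of z] by auto
      then show "1 + z \<notin> \<real>\<^sub>\<le>\<^sub>0" by (simp add: complex_nonpos_Reals_iff)
    qed
    show "(\<lambda>z. p z ^ 2 - 1) holomorphic_on ball 0 1" by (intro holomorphic_intros holp)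
    show "p z = csqrt (1 + (p z ^ 2 - 1))" if "z \<in> ball 0 1" for z
      using csqrt_unique[of "p z" "p z ^ 2"] Re_p[OF that] by simp
  qed (use holp lt p0 in auto)
  then show ?thesis using assms(1) by (simp add: class_SL_def p_def)
qed

end
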